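(* Let $n\ge 1$, let $\delta=(\delta_1,\dots,\delta_n)\in\mathbb{N}^n$, and let $p(x)=\sum_{I\le\delta}p_I x^I$ be a real polynomial in $x=(x_1,\dots,x_n)$ of degree at most $\delta_l$ in $x_l$ for each $l$. Let $p^*=\min_{x\in[0,1]^n}p(x)$, and let $p_\delta^{(1)},p_\delta^{(2)},p_\delta^{(3)}$ be the optimal values of the three Bernstein linear programs (LP1), (LP2), (LP3) defined in the context. Then $$p_\delta^{(1)}\le p_\delta^{(2)}\le p_\delta^{(3)}\le p^*.$$
   Context: Multi-index notation: for $I,J\in\mathbb{N}^n$, $I\le J$ means $i_l\le j_l$ for all $l$; $J<\delta$ means $J\le\delta$ and $J\ne\delta$; $x^I=\prod_l x_l^{i_l}$; $\binom{I}{J}=\prod_l\binom{i_l}{j_l}$; $I/J=(i_1/j_1,\dots,i_n/j_n)$ (a component $0/0$ is read as $0$). For $r\in\{1,\dots,n\}$ and $k\in\mathbb{Z}$, $I_{r,k}=(i_1,\dots,i_{r-1},i_r+k,i_{r+1},\dots,i_n)$. Bernstein polynomials: for $\delta\in\mathbb{N}^n$ and $I\le\delta$, $B_{I,\delta}(x)=\prod_{l=1}^n\binom{\delta_l}{i_l}x_l^{i_l}(1-x_l)^{\delta_l-i_l}$. The Bernstein coefficients of $p=\sum_{I\le\delta}p_Ix^I$ are $b_{I,\delta}=\sum_{J\le I}\frac{\binom{I}{J}}{\binom{\delta}{J}}p_J$ for $I\le\delta$, so that $p=\sum_{I\le\delta}b_{I,\delta}B_{I,\delta}$. The linear programs all minimize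 $\sum_{I\le\delta}b_{I,\delta}z_{I,\delta}$. (LP1): real variables $z_{I,\delta}$, $I\le\delta$, subject to $z_{I,\delta}\ge0$ for all $I\le\delta$ and $\sum_{I\le\delta}z_{I,\delta}=1$. (LP2): real variables $z_{I,\delta}$, $I\le\delta$, subject to $0\le z_{I,\delta}\le B_{I,\delta}(I/\delta)$ for all $I\le\delta$ and $\sum_{I\le\delta}z_{I,\delta}=1$. (LP3): real variables $z_{J,\delta'}$ for all $\delta'\le\delta$ (including $\delta'=\delta$) and all $J\le\delta'$, subject to: $0\le z_{J,\delta'}\le B_{J,\delta'}(J/\delta')$ for all $\delta'\le\delta$, $J\le\delta'$; $\sum_{J\le\delta'}z_{J,\delta'}=1$ for all $\delta'\le\delta$; and, for every $\delta'<\delta$, every $r$ with $\delta'_{r,1}\le\delta$, and every $J\le\delta'$, $$z_{J,\delta'}=\frac{\delta'_r+1-j_r}{\delta'_r+1}\,z_{J,\delta'_{r,1}}+\frac{j_r+1}{\delta'_r+1}\,z_{J_{r,1},\delta'_{r,1}},$$ where $\delta'_r$ is the $r$-th component of $\delta'$ and $\delta'_{r,1}$ is $\delta'$ with its $r$-th component increased by $1$. *)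

theory Defs
  imports "HOL-Analysis.Analysis"
begin

text \<open>
  The number of variables is the cardinality of the finite index type \<open>'n\<close>. Multi-indices are
  functions \<open>'n \<Rightarrow> nat\<close>, so that \<open>\<le>\<close> and \<open><\<close> are the pointwise order and its strict part, and
  \<open>{..\<delta>}\<close> is the set of all \<open>I \<le> \<delta>\<close>.
\<close>

type_synonym 'n multi_index = "'n \<Rightarrow> nat"

lemma finite_multi_index_atMost [simp, intro]: "finite {..\<delta> :: 'n::finite multi_index}"
proof -
  have "{..\<delta>} = Pi\<^sub>E UNIV (\<lambda>l. {..\<delta> l})"
    by (auto simp: le_fun_def PiE_def Pi_def)
  then show ?thesis
    by (simp add: finite_PiE)
qed

definition multi_power :: "real ^ 'n::finite \<Rightarrow> 'n multi_index \<Rightarrow> real" where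
  "multi_power x I = (\<Prod>l\<in>UNIV. (x $ l) ^ I l)"

definition multi_binomial :: "'n::finite multi_index \<Rightarrow> 'n multi_index \<Rightarrow> nat" where
  "multi_binomial I J = (\<Prod>l\<in>UNIV. I l choose J l)"

text \<open>A component \<open>0 / 0\<close> evaluates to \<open>0\<close>, by the convention for division in HOL.\<close>

definition multi_quotient :: "'n::finite multi_index \<Rightarrow> 'n multi_index \<Rightarrow> real ^ 'n" where
  "multi_quotient I J = (\<chi> l. real (I l) / real (J l))"

definition multi_incr :: "'n \<Rightarrow> 'n multi_index \<Rightarrow> 'n multi_index" where
  "multi_incr r I = I(r := I r + 1)"

text \<open>
  A polynomial of degree at most \<open>\<delta> l\<close> in the \<open>l\<close>-th variable is given by its coefficient family
  \<open>p\<close>, of which only the values \<open>p I\<close> with \<open>I \<le> \<delta>\<close> matter.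
\<close>

definition poly_fun ::
    "'n::finite multi_index \<Rightarrow> ('n multi_index \<Rightarrow> real) \<Rightarrow> real ^ 'n \<Rightarrow> real" where
  "poly_fun \<delta> p x = (\<Sum>I\<in>{..\<delta>}. p I * multi_power x I)"

definition poly_min :: "'n::finite multi_index \<Rightarrow> ('n multi_index \<Rightarrow> real) \<Rightarrow> real" where
  "poly_min \<delta> p = (LEAST v. v \<in> poly_fun \<delta> p ` cbox 0 1)"

lemma poly_min_attained:
  shows "poly_min \<delta> p \<in> poly_fun \<delta> p ` cbox 0 1"
    and "x \<in> cbox 0 1 \<Longrightarrow> poly_min \<delta> p \<le> poly_fun \<delta> p x"
proof -
  have "continuous_on (cbox 0 1) (poly_fun \<delta> p)"
    unfolding poly_fun_def multi_power_def by (intro continuous_intros)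
  moreover have "0 \<in> cbox 0 (1 :: real ^ 'a)"
    by (simp add: mem_box_cart)
  ultimately obtain y where y: "y \<in> cbox 0 1" "\<And>x. x \<in> cbox 0 1 \<Longrightarrow> poly_fun \<delta> p y \<le> poly_fun \<delta> p x"
    using continuous_attains_inf[of "cbox 0 1" "poly_fun \<delta> p"] compact_cbox by blast
  have "poly_min \<delta> p = poly_fun \<delta> p y"
    unfolding poly_min_def using y by (intro Least_equality) auto
  then show "poly_min \<delta> p \<in> poly_fun \<delta> p ` cbox 0 1"
    and "x \<in> cbox 0 1 \<Longrightarrow> poly_min \<delta> p \<le> poly_fun \<delta> p x"
    using y by auto
qed

definition bernstein ::
    "'n::finite multi_index \<Rightarrow> 'n multi_index \<Rightarrow> real ^ 'n \<Rightarrow> real" where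
  "bernstein I \<delta> x =
     (\<Prod>l\<in>UNIV. real (\<delta> l choose I l) * (x $ l) ^ I l * (1 - x $ l) ^ (\<delta> l - I l))"

definition bernstein_coeff ::
    "('n::finite multi_index \<Rightarrow> real) \<Rightarrow> 'n multi_index \<Rightarrow> 'n multi_index \<Rightarrow> real" where
  "bernstein_coeff p I \<delta> =
     (\<Sum>J\<in>{..I}. real (multi_binomial I J) / real (multi_binomial \<delta> J) * p J)"

text \<open>
  The variables of the linear programs are total functions; their values at indices outside the
  stated ranges are unconstrained and do not enter the objective.
\<close>

definition LP1_feasible :: "'n::finite multi_index \<Rightarrow> ('n multi_index \<Rightarrow> real) set" where
  "LP1_feasible \<delta> = {z. (\<forall>I\<le>\<delta>. 0 \<le> z I) \<and> (\<Sum>I\<in>{..\<delta>}. z I) = 1}"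

definition LP2_feasible :: "'n::finite multi_index \<Rightarrow> ('n multi_index \<Rightarrow> real) set" where
  "LP2_feasible \<delta> =
     {z. (\<forall>I\<le>\<delta>. 0 \<le> z I \<and> z I \<le> bernstein I \<delta> (multi_quotient I \<delta>)) \<and>
         (\<Sum>I\<in>{..\<delta>}. z I) = 1}"

definition LP3_feasible ::
    "'n::finite multi_index \<Rightarrow> ('n multi_index \<Rightarrow> 'n multi_index \<Rightarrow> real) set" where
  "LP3_feasible \<delta> =
     {z. (\<forall>\<delta>'\<le>\<delta>. \<forall>J\<le>\<delta>'. 0 \<le> z J \<delta>' \<and> z J \<delta>' \<le> bernstein J \<delta>' (multi_quotient J \<delta>')) \<and>
         (\<forall>\<delta>'\<le>\<delta>. (\<Sum>J\<in>{..\<delta>'}. z J \<delta>') = 1) \<and>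
         (\<forall>\<delta>'<\<delta>. \<forall>r. multi_incr r \<delta>' \<le> \<delta> \<longrightarrow> (\<forall>J\<le>\<delta>'.
            z J \<delta>' =
              (real (\<delta>' r) + 1 - real (J r)) / (real (\<delta>' r) + 1) * z J (multi_incr r \<delta>') +
              (real (J r) + 1) / (real (\<delta>' r) + 1) * z (multi_incr r J) (multi_incr r \<delta>')))}"

definition LP_objective ::
    "'n::finite multi_index \<Rightarrow> ('n multi_index \<Rightarrow> real) \<Rightarrow> ('n multi_index \<Rightarrow> real) \<Rightarrow> real" where
  "LP_objective \<delta> p z = (\<Sum>I\<in>{..\<delta>}. bernstein_coeff p I \<delta> * z I)"

text \<open>
  Optimal values of minimization problems are taken in the extended reals: \<open>\<infinity>\<close> for an infeasible
  program and \<open>-\<infinity>\<close> for an unbounded one.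
\<close>

definition LP1_value :: "'n::finite multi_index \<Rightarrow> ('n multi_index \<Rightarrow> real) \<Rightarrow> ereal" where
  "LP1_value \<delta> p = (INF z\<in>LP1_feasible \<delta>. ereal (LP_objective \<delta> p z))"

definition LP2_value :: "'n::finite multi_index \<Rightarrow> ('n multi_index \<Rightarrow> real) \<Rightarrow> ereal" where
  "LP2_value \<delta> p = (INF z\<in>LP2_feasible \<delta>. ereal (LP_objective \<delta> p z))"

definition LP3_value :: "'n::finite multi_index \<Rightarrow> ('n multi_index \<Rightarrow> real) \<Rightarrow> ereal" where
  "LP3_value \<delta> p = (INF z\<in>LP3_feasible \<delta>. ereal (LP_objective \<delta> p (\<lambda>I. z I \<delta>)))"

end

theory Submission
  imports Defs
begin

text \<open>
  Each linear program adds constraints to the one before it, and (LP3) contains a copy of (LP2)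
  in its variables of top degree, so the optimal values increase along the sequence. The last
  inequality holds because every point \<open>x\<close> of the unit box gives a feasible point of (LP3), namely
  the family \<open>z J \<delta>' = bernstein J \<delta>' x\<close> of values of the Bernstein polynomials at \<open>x\<close>, whose
  objective value is the value of the polynomial at \<open>x\<close>. It remains to take for \<open>x\<close> a minimizer.

  Feasibility of this family, and its objective value, amount to four facts about multivariate
  Bernstein polynomials: each one attains its maximum over the box at \<open>J / \<delta>'\<close>
  (\<open>bernstein_le_at_quotient\<close>), they form a partition of unity (\<open>sum_bernstein\<close>), they satisfy the
  degree raising identity (\<open>bernstein_raise_degree\<close>), and they reproduce monomials
  (\<open>monomial_bernstein_expansion\<close>). As a multivariate Bernstein polynomial is a product of
  univariate ones, all four reduce to one variable: the first by comparing factors, the third by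
  isolating one factor, and the other two by exchanging the product with the sum over
  multi-indices.
\<close>

section \<open>Univariate Bernstein polynomials\<close>

text \<open>
  For positive \<open>k\<close>, this is \<open>1 + t \<le> exp t\<close> with \<open>t = d * a / k - 1\<close>, raised to the power \<open>k\<close>. When such bounds are
  multiplied over several \<open>k\<close> with sum \<open>d\<close> and several \<open>a\<close> with sum \<open>1\<close>, the exponentials cancel.
\<close>

lemma power_le_exp_tangent:
  fixes a d :: real
  assumes "0 \<le> a" "0 < d"
  shows "a ^ k \<le> (real k / d) ^ k * exp (d * a - real k)"
proof (cases "k = 0")
  case True
  then show ?thesis using assms by simp
next
  case False
  define t where "t = d * a / real k - 1"
  have "a = real k / d * (1 + t)"
    using False assms by (simp add: t_def field_simps)
  also have "\<dots> \<le> real k / d * exp t"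
    using assms by (intro mult_left_mono exp_ge_add_one_self) auto
  finally have "a ^ k \<le> (real k / d * exp t) ^ k"
    using assms by (intro power_mono) auto
  also have "\<dots> = (real k / d) ^ k * exp (real k * t)"
    by (simp only: power_mult_distrib exp_of_nat_mult)
  also have "real k * t = d * a - real k"
    using False by (simp add: t_def field_simps)
  finally show ?thesis .
qed

lemma Bernstein_le_at_quotient:
  assumes "0 \<le> x" "x \<le> 1" "i \<le> d"
  shows "Bernstein d i x \<le> Bernstein d i (real i / real d)"
proof (cases "d = 0")
  case True
  then show ?thesis using assms by (simp add: Bernstein_def)
next
  case False
  then have d: "0 < real d" by simp
  have quot: "real (d - i) / real d = 1 - real i / real d"
    using d assms by (simp add: field_simps of_nat_diff)
  have "x ^ i * (1 - x) ^ (d - i)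
      \<le> ((real i / real d) ^ i * exp (real d * x - real i)) *
        ((real (d - i) / real d) ^ (d - i) * exp (real d * (1 - x) - real (d - i)))"
    using assms d by (intro mult_mono power_le_exp_tangent) auto
  also have "\<dots> = (real i / real d) ^ i * (real (d - i) / real d) ^ (d - i) *
      exp ((real d * x - real i) + (real d * (1 - x) - real (d - i)))"
    by (simp only: exp_add mult_ac)
  also have "(real d * x - real i) + (real d * (1 - x) - real (d - i)) = 0"
    using assms by (simp add: of_nat_diff algebra_simps)
  finally have "x ^ i * (1 - x) ^ (d - i)
      \<le> (real i / real d) ^ i * (1 - real i / real d) ^ (d - i)"
    by (simp add: quot)
  then show ?thesis
    unfolding Bernstein_def mult.assoc by (intro mult_left_mono) auto
qed

text \<open>
  The two summands are \<open>1 - x\<close> and \<open>x\<close> times the left-hand side, by the absorption identities for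
  binomial coefficients.
\<close>

lemma Bernstein_raise_degree:
  assumes "j \<le> d"
  shows "Bernstein d j x =
    (real d + 1 - real j) / (real d + 1) * Bernstein (d + 1) j x +
    (real j + 1) / (real d + 1) * Bernstein (d + 1) (j + 1) x"
proof -
  have "real ((Suc d - j) * (Suc d choose j)) = real (Suc d * (d choose j))"
    by (simp only: binomial_absorb_comp diff_Suc_1)
  moreover have "real (Suc d - j) = real d + 1 - real j" "real (Suc d) = real d + 1"
    using assms by (simp_all add: of_nat_diff)
  ultimately have "(real d + 1 - real j) * real (Suc d choose j) = (real d + 1) * real (d choose j)"
    by (simp only: of_nat_mult)
  then have "(real d + 1 - real j) / (real d + 1) * real (Suc d choose j) = real (d choose j)"
    by (simp add: field_simps)
  then have "(real d + 1 - real j) / (real d + 1) * real (Suc d choose j) *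
        (x ^ j * (1 - x) ^ Suc (d - j))
      = real (d choose j) * (x ^ j * (1 - x) ^ Suc (d - j))"
    by (simp only:)
  then have low: "(real d + 1 - real j) / (real d + 1) * Bernstein (d + 1) j x
      = (1 - x) * Bernstein d j x"
    using assms by (simp add: Bernstein_def Suc_diff_le mult_ac)
  have "real (Suc j * (Suc d choose Suc j)) = real (Suc d * (d choose j))"
    by (simp only: Suc_times_binomial_eq mult.commute[of "Suc j"])
  then have "(real j + 1) * real (Suc d choose Suc j) = (real d + 1) * real (d choose j)"
    unfolding of_nat_mult of_nat_Suc by (simp only: add.commute)
  then have "(real j + 1) / (real d + 1) * real (Suc d choose Suc j) = real (d choose j)"
    by (simp add: field_simps del: binomial_Suc_Suc)
  then have "(real j + 1) / (real d + 1) * real (Suc d choose Suc j) * (x ^ Suc j * (1 - x) ^ (d - j))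
      = real (d choose j) * (x ^ Suc j * (1 - x) ^ (d - j))"
    by (simp only:)
  then have high: "(real j + 1) / (real d + 1) * Bernstein (d + 1) (j + 1) x = x * Bernstein d j x"
    by (simp add: Bernstein_def mult_ac del: binomial_Suc_Suc)
  show ?thesis
    unfolding low high by (simp add: algebra_simps)
qed

text \<open>
  After factoring out \<open>x ^ j\<close>, the nonzero terms on the left are the Bernstein polynomials of
  degree \<open>d - j\<close>, which sum to \<open>1\<close>.
\<close>

lemma power_Bernstein_expansion:
  assumes "j \<le> d"
  shows "(\<Sum>i\<le>d. real (i choose j) / real (d choose j) * Bernstein d i x) = x ^ j"
proof -
  have shift: "real (k + j choose j) / real (d choose j) * Bernstein d (k + j) x
      = x ^ j * Bernstein (d - j) k x" if "k \<le> d - j" for k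
  proof -
    have "(d choose (k + j)) * (k + j choose j) = (d choose j) * (d - j choose k)"
      using choose_mult[of j "k + j" d] that assms by simp
    then have "real (d choose (k + j)) * real (k + j choose j)
        = real (d choose j) * real (d - j choose k)"
      by (simp only: of_nat_mult[symmetric])
    then have "real (k + j choose j) / real (d choose j) * real (d choose (k + j))
        = real (d - j choose k)"
      using assms by (simp add: field_simps)
    then have "real (k + j choose j) / real (d choose j) * real (d choose (k + j)) *
          (x ^ (k + j) * (1 - x) ^ (d - (k + j)))
        = real (d - j choose k) * (x ^ (k + j) * (1 - x) ^ (d - (k + j)))"
      by (simp only:)
    then show ?thesis
      by (simp add: Bernstein_def power_add mult_ac add.commute)
  qed
  have "(\<Sum>i\<le>d. real (i choose j) / real (d choose j) * Bernstein d i x)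
      = (\<Sum>i=0+j..(d-j)+j. real (i choose j) / real (d choose j) * Bernstein d i x)"
    using assms by (intro sum.mono_neutral_right) auto
  also have "\<dots> = (\<Sum>k=0..d-j. x ^ j * Bernstein (d - j) k x)"
    unfolding sum.shift_bounds_cl_nat_ivl by (intro sum.cong shift) auto
  also have "\<dots> = x ^ j"
    by (simp add: sum_distrib_left[symmetric] atMost_atLeast0[symmetric])
  finally show ?thesis .
qed

section \<open>Multivariate Bernstein polynomials\<close>

lemma bernstein_eq_prod_Bernstein:
  "bernstein I \<delta> x = (\<Prod>l\<in>UNIV. Bernstein (\<delta> l) (I l) (x $ l))"
  by (simp add: bernstein_def Bernstein_def)

lemma sum_multi_index_prod:
  fixes \<delta> :: "'n::finite multi_index" and f :: "'n \<Rightarrow> nat \<Rightarrow> 'a::comm_semiring_1"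
  shows "(\<Sum>I\<in>{..\<delta>}. \<Prod>l\<in>UNIV. f l (I l)) = (\<Prod>l\<in>UNIV. \<Sum>i\<le>\<delta> l. f l i)"
proof -
  have "{..\<delta>} = Pi\<^sub>E UNIV (\<lambda>l. {..\<delta> l})"
    by (auto simp: le_fun_def PiE_def Pi_def)
  then show ?thesis
    by (simp add: prod_sum_PiE)
qed

lemma bernstein_nonneg:
  assumes "x \<in> cbox 0 1"
  shows "0 \<le> bernstein I \<delta> x"
  using assms unfolding bernstein_eq_prod_Bernstein
  by (intro prod_nonneg) (simp add: mem_box_cart Bernstein_nonneg)

lemma bernstein_le_at_quotient:
  assumes "x \<in> cbox 0 1" "I \<le> \<delta>"
  shows "bernstein I \<delta> x \<le> bernstein I \<delta> (multi_quotient I \<delta>)"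
  using assms unfolding bernstein_eq_prod_Bernstein
  by (intro prod_mono)
    (simp add: mem_box_cart Bernstein_nonneg multi_quotient_def Bernstein_le_at_quotient le_fun_def)

lemma sum_bernstein: "(\<Sum>I\<in>{..\<delta>}. bernstein I \<delta> x) = 1"
  unfolding bernstein_eq_prod_Bernstein
  by (subst sum_multi_index_prod[where f = "\<lambda>l i. Bernstein (\<delta> l) i (x $ l)"]) simp

lemma bernstein_raise_degree:
  assumes "J \<le> \<delta>"
  shows "bernstein J \<delta> x =
    (real (\<delta> r) + 1 - real (J r)) / (real (\<delta> r) + 1) * bernstein J (multi_incr r \<delta>) x +
    (real (J r) + 1) / (real (\<delta> r) + 1) * bernstein (multi_incr r J) (multi_incr r \<delta>) x"
proof -
  define R where "R = (\<Prod>l\<in>UNIV - {r}. Bernstein (\<delta> l) (J l) (x $ l))"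
  have split: "bernstein K \<epsilon> x = Bernstein (\<epsilon> r) (K r) (x $ r) * R"
    if "\<And>l. l \<noteq> r \<Longrightarrow> K l = J l \<and> \<epsilon> l = \<delta> l" for K \<epsilon>
  proof -
    have "(\<Prod>l\<in>UNIV - {r}. Bernstein (\<epsilon> l) (K l) (x $ l)) = R"
      unfolding R_def using that by (intro prod.cong) auto
    then show ?thesis
      unfolding bernstein_eq_prod_Bernstein by (subst prod.remove[of UNIV r]) auto
  qed
  have "J r \<le> \<delta> r"
    using assms by (simp add: le_fun_def)
  note raise = Bernstein_raise_degree[OF this, of "x $ r"]
  have "bernstein J \<delta> x = Bernstein (\<delta> r) (J r) (x $ r) * R"
    "bernstein J (multi_incr r \<delta>) x = Bernstein (\<delta> r + 1) (J r) (x $ r) * R"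
    "bernstein (multi_incr r J) (multi_incr r \<delta>) x = Bernstein (\<delta> r + 1) (J r + 1) (x $ r) * R"
    by (subst split; simp add: multi_incr_def)+
  then show ?thesis
    using raise by (simp only: distrib_right mult.assoc)
qed

lemma monomial_bernstein_expansion:
  assumes "J \<le> \<delta>"
  shows "(\<Sum>I\<in>{..\<delta>}. real (multi_binomial I J) / real (multi_binomial \<delta> J) * bernstein I \<delta> x)
    = multi_power x J"
proof -
  have "(\<Sum>I\<in>{..\<delta>}. real (multi_binomial I J) / real (multi_binomial \<delta> J) * bernstein I \<delta> x)
      = (\<Sum>I\<in>{..\<delta>}. \<Prod>l\<in>UNIV.
          real (I l choose J l) / real (\<delta> l choose J l) * Bernstein (\<delta> l) (I l) (x $ l))"
    by (simp add: multi_binomial_def bernstein_eq_prod_Bernstein prod.distrib prod_dividef)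
  also have "\<dots> = (\<Prod>l\<in>UNIV. \<Sum>i\<le>\<delta> l.
      real (i choose J l) / real (\<delta> l choose J l) * Bernstein (\<delta> l) i (x $ l))"
    by (rule sum_multi_index_prod)
  also have "\<dots> = multi_power x J"
    unfolding multi_power_def
    using assms by (intro prod.cong power_Bernstein_expansion) (auto simp: le_fun_def)
  finally show ?thesis .
qed

text \<open>
  The index range of the inner sum over \<open>J \<le> I\<close> can be enlarged to all \<open>J \<le> \<delta>\<close>, because the
  binomial coefficient vanishes outside it; then the two sums can be exchanged.
\<close>

lemma poly_fun_bernstein_expansion:
  "(\<Sum>I\<in>{..\<delta>}. bernstein_coeff p I \<delta> * bernstein I \<delta> x) = poly_fun \<delta> p x"
proof -
  have coeff: "bernstein_coeff p I \<delta>
      = (\<Sum>J\<in>{..\<delta>}. real (multi_binomial I J) / real (multi_binomial \<delta> J) * p J)"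
    if "I \<le> \<delta>" for I
  proof -
    have "multi_binomial I J = 0" if "\<not> J \<le> I" for J
      using that by (auto simp: multi_binomial_def le_fun_def not_le)
    then show ?thesis
      unfolding bernstein_coeff_def using that order_trans[OF _ that]
      by (intro sum.mono_neutral_left) auto
  qed
  have "(\<Sum>I\<in>{..\<delta>}. bernstein_coeff p I \<delta> * bernstein I \<delta> x)
      = (\<Sum>I\<in>{..\<delta>}. \<Sum>J\<in>{..\<delta>}. p J *
          (real (multi_binomial I J) / real (multi_binomial \<delta> J) * bernstein I \<delta> x))"
    by (intro sum.cong) (auto simp: coeff sum_distrib_left sum_distrib_right mult_ac)
  also have "\<dots> = (\<Sum>J\<in>{..\<delta>}. p J *
      (\<Sum>I\<in>{..\<delta>}. real (multi_binomial I J) / real (multi_binomial \<delta> J) * bernstein I \<delta> x))"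
    by (subst sum.swap) (simp add: sum_distrib_left)
  also have "\<dots> = poly_fun \<delta> p x"
    unfolding poly_fun_def by (intro sum.cong) (simp_all only: monomial_bernstein_expansion atMost_iff)
  finally show ?thesis .
qed

section \<open>The hierarchy of linear programs\<close>

lemma LP2_feasible_subset_LP1_feasible: "LP2_feasible \<delta> \<subseteq> LP1_feasible \<delta>"
  by (auto simp: LP1_feasible_def LP2_feasible_def)

lemma LP3_feasible_top_in_LP2_feasible:
  assumes "z \<in> LP3_feasible \<delta>"
  shows "(\<lambda>I. z I \<delta>) \<in> LP2_feasible \<delta>"
  using assms by (simp add: LP3_feasible_def LP2_feasible_def)

lemma bernstein_in_LP3_feasible:
  assumes "x \<in> cbox 0 1"
  shows "(\<lambda>J \<delta>'. bernstein J \<delta>' x) \<in> LP3_feasible \<delta>"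
  unfolding LP3_feasible_def mem_Collect_eq
  using assms
  by (intro conjI allI impI bernstein_nonneg bernstein_le_at_quotient bernstein_raise_degree
      sum_bernstein)

theorem proposition3p2:
  fixes \<delta> :: "'n::finite multi_index" and p :: "'n multi_index \<Rightarrow> real"
  shows "LP1_value \<delta> p \<le> LP2_value \<delta> p \<and>
         LP2_value \<delta> p \<le> LP3_value \<delta> p \<and>
         LP3_value \<delta> p \<le> ereal (poly_min \<delta> p)"
proof (intro conjI)
  show "LP1_value \<delta> p \<le> LP2_value \<delta> p"
    unfolding LP1_value_def LP2_value_def
    by (intro INF_superset_mono LP2_feasible_subset_LP1_feasible order_refl)
  show "LP2_value \<delta> p \<le> LP3_value \<delta> p"
    unfolding LP2_value_def LP3_value_def
    by (intro INF_greatest INF_lower LP3_feasible_top_in_LP2_feasible)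
  obtain x where x: "x \<in> cbox 0 1" "poly_min \<delta> p = poly_fun \<delta> p x"
    using poly_min_attained(1)[of \<delta> p] by blast
  have "LP3_value \<delta> p \<le> ereal (LP_objective \<delta> p (\<lambda>I. bernstein I \<delta> x))"
    unfolding LP3_value_def by (rule INF_lower[OF bernstein_in_LP3_feasible[OF x(1)]])
  also have "LP_objective \<delta> p (\<lambda>I. bernstein I \<delta> x) = poly_min \<delta> p"
    unfolding LP_objective_def x(2) by (rule poly_fun_bernstein_expansion)
  finally show "LP3_value \<delta> p \<le> ereal (poly_min \<delta> p)" .
qed

end
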